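(* Let $0<\theta<1$, $\xi\in[0,1)$, $y\le0$ and $\lambda=(1-\xi)(1-\theta)$. Then, as $n\to\infty$, $$p_n^{\xi,y}(\theta)\sim\frac{1}{\lambda(\theta;\theta)_\infty}\,h(y)\,\lambda^{n+1},$$ where, for $y\le0$, $$h(y)=e^{\frac{\theta y}{1-\theta}}\sum_{m=0}^\infty\frac{\left(-\frac{\theta y}{1-\theta}\right)^m}{m!}\left(\frac{-\xi}{\lambda}(1-\theta);\theta\right)_m.$$
   Context: For $\xi\in[0,1]$ let $\phi_\xi(x)=\xi e^{x}$ for $x<0$ and $\phi_\xi(x)=(1-\xi)e^{-x}$ for $x>0$, and let $(X_i)_{i\ge0}$ be i.i.d. with density $\phi_\xi$. For $y\in\mathbb{R}$ put $p_0^{\xi,y}(\theta)=1$ and $p_n^{\xi,y}(\theta)=\mathbb{P}(X_2>\theta y,X_3>\theta X_2,\dots,X_{n+1}>\theta X_n)$ for $n\ge1$. $(a;q)_m=\prod_{k=0}^{m-1}(1-aq^k)$ and $(a;q)_\infty=\prod_{k=0}^\infty(1-aq^k)$ for $0<q<1$. $a_n\sim b_n$ means $a_n/b_n\to1$. *)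

theory Defs
  imports "HOL-Probability.Probability"
begin

text \<open>The value of the density at \<open>0\<close> is left open in the source (it concerns a null set);
  it is set to \<open>0\<close> here.\<close>

definition phi :: "real \<Rightarrow> real \<Rightarrow> real" where
  "phi \<xi> x = (if x < 0 then \<xi> * exp x else if x > 0 then (1 - \<xi>) * exp (- x) else 0)"

text \<open>\<open>persist_prob M X \<theta> y n\<close> is \<open>p\<^sub>n(\<theta>)\<close>.  It depends on \<open>\<xi>\<close> only through the common law of
  the \<open>X i\<close>.  For \<open>n = 1\<close> the range \<open>{2..n}\<close> is empty and only \<open>X 2 > \<theta> y\<close> remains; the
  value \<open>1\<close> for \<open>n = 0\<close> is a convention.\<close>

definition persist_prob ::
    "'a measure \<Rightarrow> (nat \<Rightarrow> 'a \<Rightarrow> real) \<Rightarrow> real \<Rightarrow> real \<Rightarrow> nat \<Rightarrow> real" where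
  "persist_prob M X \<theta> y n =
     (if n = 0 then 1
      else \<P>(\<omega> in M. X 2 \<omega> > \<theta> * y \<and> (\<forall>k\<in>{2..n}. X (k + 1) \<omega> > \<theta> * X k \<omega>)))"

definition qpoch :: "real \<Rightarrow> real \<Rightarrow> nat \<Rightarrow> real" where
  "qpoch a q m = (\<Prod>k<m. 1 - a * q ^ k)"

definition qpoch_inf :: "real \<Rightarrow> real \<Rightarrow> real" where
  "qpoch_inf a q = (\<Prod>k. 1 - a * q ^ k)"

definition h_fun :: "real \<Rightarrow> real \<Rightarrow> real \<Rightarrow> real \<Rightarrow> real" where
  "h_fun \<theta> \<xi> lam y =
     exp (\<theta> * y / (1 - \<theta>)) *
     (\<Sum>m. (- (\<theta> * y / (1 - \<theta>))) ^ m / fact m * qpoch (- \<xi> / lam * (1 - \<theta>)) \<theta> m)"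

end

theory Submission
  imports Defs
begin

text \<open>Conditioning on \<open>X 2\<close> gives \<open>p\<^sub>n\<^sub>+\<^sub>1(y) = \<integral> \<phi>(x) p\<^sub>n(x) dx\<close> over \<open>x > \<theta> y\<close>.  On \<open>y \<ge> 0\<close> only the
  positive exponential branch enters, so there \<open>p\<^sub>n(y) = a\<^sub>n exp (- c\<^sub>n y)\<close> with
  \<open>a\<^sub>n = lam ^ n / qpoch \<theta> \<theta> n\<close>.  On \<open>y \<le> 0\<close> the ratio \<open>p\<^sub>n / a\<^sub>n\<close> obeys a Volterra recursion with factor
  \<open>(\<xi> / lam) (1 - \<theta> ^ n)\<close>; the function \<open>h\<close> solves the limiting Volterra equation (with factor
  \<open>\<xi> / lam\<close>), and the recursion contracts towards it in an exponentially weighted supremum norm.\<close>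

section \<open>The persistence event as a recursive predicate on a product space\<close>

text \<open>The base point \<open>y\<close> and the start index \<open>s\<close> are arguments so
  that removing the first comparison leaves an event of the same shape, based at \<open>x s\<close>;
  this is the Markov structure used below.\<close>

primrec chain :: "real \<Rightarrow> nat \<Rightarrow> nat \<Rightarrow> real \<Rightarrow> (nat \<Rightarrow> real) \<Rightarrow> bool" where
  "chain \<theta> 0 s y x \<longleftrightarrow> True"
| "chain \<theta> (Suc n) s y x \<longleftrightarrow> \<theta> * y < x s \<and> chain \<theta> n (Suc s) (x s) x"

lemma chain_Suc_iff:
  "chain \<theta> (Suc n) s y x \<longleftrightarrow> \<theta> * y < x s \<and> (\<forall>k\<in>{s..<s + n}. \<theta> * x k < x (Suc k))"
proof (induction n arbitrary: s y)
  case (Suc n)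
  have "{s..<s + Suc n} = insert s {Suc s..<Suc s + n}"
    by auto
  then show ?case
    using Suc.IH[of "Suc s" "x s"] by simp
qed simp

lemma chain_fun_upd: "i < s \<Longrightarrow> chain \<theta> n s y (x(i := v)) \<longleftrightarrow> chain \<theta> n s y x"
  by (induction n arbitrary: s y) auto

text \<open>Only the coordinates \<open>s, ..., s + n - 1\<close> are read. This lets the full
  family \<open>X\<close> be replaced by its restriction, a point of the product space.\<close>

lemma chain_restrict: "{s..<s + n} \<subseteq> I \<Longrightarrow> chain \<theta> n s y (restrict x I) \<longleftrightarrow> chain \<theta> n s y x"
proof (induction n arbitrary: s y)
  case (Suc n)
  have "s \<in> I" "{Suc s..<Suc s + n} \<subseteq> I"
    using Suc.prems by auto
  then show ?case
    using Suc.IH[of "Suc s"] by simp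
qed simp

text \<open>The base point is a function \<open>g\<close> of \<open>x\<close> because the induction
  step replaces it by the coordinate \<open>x s\<close>; a constant \<open>g\<close> would not
  survive the induction.\<close>

lemma measurable_chain:
  assumes "g \<in> borel_measurable (PiM I (\<lambda>_. D))" and "sets D = sets borel" and "{s..<s + n} \<subseteq> I"
  shows "Measurable.pred (PiM I (\<lambda>_. D)) (\<lambda>x. chain \<theta> n s (g x) x)"
  using assms
proof (induction n arbitrary: s g)
  case (Suc n)
  have "s \<in> I" "{Suc s..<Suc s + n} \<subseteq> I"
    using Suc.prems(3) by auto
  then have s: "(\<lambda>x. x s) \<in> borel_measurable (PiM I (\<lambda>_. D))"
    using measurable_component_singleton[of s I "\<lambda>_. D"]
      measurable_cong_sets[OF refl Suc.prems(2), of "PiM I (\<lambda>_. D)"] by metis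
  have [measurable]: "Measurable.pred (PiM I (\<lambda>_. D)) (\<lambda>x. chain \<theta> n (Suc s) (x s) x)"
    by (rule Suc.IH) (fact s Suc.prems \<open>{Suc s..<Suc s + n} \<subseteq> I\<close>)+
  note [measurable] = s Suc.prems(1)
  show ?case
    by simp
qed simp

definition chain_prob :: "real measure \<Rightarrow> real \<Rightarrow> nat \<Rightarrow> nat \<Rightarrow> real \<Rightarrow> ennreal" where
  "chain_prob D \<theta> n s y = (\<integral>\<^sup>+x. indicator {x. chain \<theta> n s y x} x \<partial>PiM {s..<s + n} (\<lambda>_. D))"

lemma chain_prob_0:
  assumes "prob_space D"
  shows "chain_prob D \<theta> 0 s y = 1"
proof -
  interpret prob_space "PiM {s..<s} (\<lambda>_. D)"
    by (intro prob_space_PiM assms)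
  show ?thesis
    using emeasure_space_1 by (simp add: chain_prob_def)
qed

text \<open>Tonelli on the product with coordinate \<open>s\<close> split off: the first comparison
  involves \<open>z\<close> alone, and the rest is a chain on the later coordinates based at
  \<open>z\<close>.\<close>

lemma chain_prob_Suc:
  assumes "prob_space D" and D: "sets D = sets borel"
  shows "chain_prob D \<theta> (Suc n) s y =
    (\<integral>\<^sup>+z. indicator {\<theta> * y<..} z * chain_prob D \<theta> n (Suc s) z \<partial>D)"
proof -
  interpret D: prob_space D by fact
  interpret product_sigma_finite "\<lambda>_::nat. D" by unfold_locales
  let ?I = "{Suc s..<Suc s + n}"
  have I: "{s..<s + Suc n} = insert s ?I" by auto
  have "Measurable.pred (PiM (insert s ?I) (\<lambda>_. D)) (\<lambda>x. chain \<theta> (Suc n) s y x)"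
    by (rule measurable_chain) (use D in auto)
  then have m: "(\<lambda>x. indicator {x. chain \<theta> (Suc n) s y x} x :: ennreal)
      \<in> borel_measurable (PiM (insert s ?I) (\<lambda>_. D))"
    by (intro borel_measurable_indicator') (simp add: pred_def del: chain.simps)
  have m': "(\<lambda>x. indicator {x. chain \<theta> n (Suc s) z x} x :: ennreal)
      \<in> borel_measurable (PiM ?I (\<lambda>_. D))" for z
  proof -
    have "Measurable.pred (PiM ?I (\<lambda>_. D)) (\<lambda>x. chain \<theta> n (Suc s) z x)"
      by (rule measurable_chain) (use D in auto)
    then show ?thesis by measurable
  qed
  have "chain_prob D \<theta> (Suc n) s y =
      (\<integral>\<^sup>+z. (\<integral>\<^sup>+x. indicator {x. chain \<theta> (Suc n) s y x} (x(s := z)) \<partial>PiM ?I (\<lambda>_. D)) \<partial>D)"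
    unfolding chain_prob_def I by (rule product_nn_integral_insert_rev[OF _ _ m]) simp_all
  also have "\<dots> = (\<integral>\<^sup>+z. (\<integral>\<^sup>+x. indicator {\<theta> * y<..} z * indicator {x. chain \<theta> n (Suc s) z x} x
      \<partial>PiM ?I (\<lambda>_. D)) \<partial>D)"
    by (intro nn_integral_cong) (auto simp: indicator_def chain_fun_upd)
  also have "\<dots> = (\<integral>\<^sup>+z. indicator {\<theta> * y<..} z * chain_prob D \<theta> n (Suc s) z \<partial>D)"
    unfolding chain_prob_def by (intro nn_integral_cong nn_integral_cmult m')
  finally show ?thesis .
qed

text \<open>Independence makes the joint law of \<open>X 2, ..., X (n + 1)\<close> the product
  measure, so the probability is an integral over that product.\<close>

lemma persist_prob_eq_chain_prob:
  fixes M :: "'a measure" and X :: "nat \<Rightarrow> 'a \<Rightarrow> real"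
  assumes M: "prob_space M" and indep: "prob_space.indep_vars M (\<lambda>_. borel) X UNIV"
    and distr: "\<And>i. distr M borel (X i) = D" and n: "0 < n"
  shows "ennreal (persist_prob M X \<theta> y n) = chain_prob D \<theta> n 2 y"
proof -
  interpret prob_space M by fact
  have rv: "random_variable borel (X i)" for i
    using indep unfolding indep_vars_def by auto
  note [measurable] = rv
  let ?I = "{2..<2 + n}"
  let ?P = "PiM ?I (\<lambda>_. borel) :: (nat \<Rightarrow> real) measure"
  have "indep_vars (\<lambda>_. borel) X ?I"
    by (rule indep_vars_subset[OF indep]) auto
  then have PiM: "distr M ?P (\<lambda>\<omega>. \<lambda>i\<in>?I. X i \<omega>) = PiM ?I (\<lambda>_. D)"
    using indep_vars_iff_distr_eq_PiM[where I = ?I and M' = "\<lambda>_. borel" and X = X] rv n by (simp add: distr)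
  have m: "Measurable.pred ?P (\<lambda>x. chain \<theta> n 2 y x)"
    by (rule measurable_chain) auto
  then have mi: "(\<lambda>x. indicator {x. chain \<theta> n 2 y x} x :: ennreal) \<in> borel_measurable ?P"
    by measurable
  have mX: "(\<lambda>\<omega>. \<lambda>i\<in>?I. X i \<omega>) \<in> measurable M ?P"
    by measurable
  have ev: "{\<omega> \<in> space M. chain \<theta> n 2 y (\<lambda>i. X i \<omega>)} \<in> events"
  proof -
    have "Measurable.pred M (\<lambda>\<omega>. chain \<theta> n 2 y (\<lambda>i\<in>?I. X i \<omega>))"
      using measurable_compose[OF mX m] .
    then show ?thesis
      by (simp add: chain_restrict pred_def)
  qed
  obtain m' where m': "n = Suc m'"
    using n by (cases n) auto
  have iff: "X 2 \<omega> > \<theta> * y \<and> (\<forall>k\<in>{2..n}. X (k + 1) \<omega> > \<theta> * X k \<omega>)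
      \<longleftrightarrow> chain \<theta> n 2 y (\<lambda>i. X i \<omega>)" for \<omega>
  proof -
    \<comment> \<open>Of the \<open>n\<close> comparisons the first is against \<open>y\<close>, so
      \<open>n - 1 = m'\<close> remain; there are none for \<open>n = 1\<close>.\<close>
    have "{2..n} = {2..<2 + m'}"
      using m' by auto
    then show ?thesis
      unfolding m' chain_Suc_iff by simp
  qed
  have "ennreal (persist_prob M X \<theta> y n) = emeasure M {\<omega> \<in> space M. chain \<theta> n 2 y (\<lambda>i. X i \<omega>)}"
    using n unfolding persist_prob_def iff by (simp add: emeasure_eq_measure)
  also have "\<dots> = (\<integral>\<^sup>+\<omega>. indicator {\<omega> \<in> space M. chain \<theta> n 2 y (\<lambda>i. X i \<omega>)} \<omega> \<partial>M)"
    using ev by simp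
  also have "\<dots> = (\<integral>\<^sup>+\<omega>. indicator {x. chain \<theta> n 2 y x} (\<lambda>i\<in>?I. X i \<omega>) \<partial>M)"
    by (intro nn_integral_cong) (auto simp: indicator_def chain_restrict)
  also have "\<dots> = (\<integral>\<^sup>+x. indicator {x. chain \<theta> n 2 y x} x \<partial>distr M ?P (\<lambda>\<omega>. \<lambda>i\<in>?I. X i \<omega>))"
    by (subst nn_integral_distr[OF mX]) (use mi in simp_all)
  also have "\<dots> = chain_prob D \<theta> n 2 y"
    unfolding chain_prob_def PiM ..
  finally show ?thesis .
qed

section \<open>The correction factor on the negative half-line\<close>

text \<open>The ratio \<open>p\<^sub>n(- z) / p\<^sub>n(0)\<close> for \<open>z \<ge> 0\<close>.  For \<open>z < 0\<close> the empty integral makes it the constant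
  \<open>1\<close>, so it is continuous on the whole line.\<close>

primrec neg_factor :: "real \<Rightarrow> real \<Rightarrow> nat \<Rightarrow> real \<Rightarrow> real" where
  "neg_factor K \<theta> 0 z = 1"
| "neg_factor K \<theta> (Suc n) z =
     1 + K * (1 - \<theta> ^ Suc n) * integral {0..\<theta> * z} (\<lambda>x. exp (- x) * neg_factor K \<theta> n x)"

lemma continuous_on_indefinite_integral_UNIV:
  fixes f :: "real \<Rightarrow> real"
  assumes "continuous_on UNIV f"
  shows "continuous_on UNIV (\<lambda>x. integral {0..x} f)"
proof -
  \<comment> \<open>For negative \<open>x\<close> the left interval is empty and the right one is a
    point, so both integrals vanish. Clamping keeps the upper limit where continuity of the
    indefinite integral is available.\<close>
  have eq: "integral {0..x} f = integral {0..max 0 x} f" for x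
    by (cases "x < 0") (auto simp: max_def)
  have "isCont (\<lambda>x. integral {0..max 0 x} f) x" for x
  proof -
    have "continuous_on {0..\<bar>x\<bar> + 1} (\<lambda>x. integral {0..x} f)"
      by (intro indefinite_integral_continuous_1 integrable_continuous_real
          continuous_on_subset[OF assms]) auto
    moreover have "continuous_on {-\<bar>x\<bar> - 1<..<\<bar>x\<bar> + 1} (\<lambda>x. max 0 x)"
      by (intro continuous_intros)
    ultimately have "continuous_on {-\<bar>x\<bar> - 1<..<\<bar>x\<bar> + 1} (\<lambda>x. integral {0..max 0 x} f)"
      by (rule continuous_on_compose2) auto
    then show ?thesis
      by (rule continuous_on_interior) auto
  qed
  then show ?thesis
    by (subst eq) (simp add: continuous_at_imp_continuous_on)
qed

lemma continuous_on_neg_factor: "continuous_on UNIV (neg_factor K \<theta> n)"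
proof (induction n)
  case (Suc n)
  have "continuous_on UNIV (\<lambda>x. integral {0..x} (\<lambda>x. exp (- x) * neg_factor K \<theta> n x))"
    by (intro continuous_on_indefinite_integral_UNIV continuous_intros Suc.IH)
  then have "continuous_on UNIV (\<lambda>z. integral {0..\<theta> * z} (\<lambda>x. exp (- x) * neg_factor K \<theta> n x))"
    by (rule continuous_on_compose2) (auto intro!: continuous_intros)
  then show ?case
    by (auto intro!: continuous_intros)
qed simp

lemma neg_factor_integrable:
  "(\<lambda>x. exp (- x) * neg_factor K \<theta> n x) integrable_on {a..b}"
  by (intro integrable_continuous_real continuous_intros
      continuous_on_subset[OF continuous_on_neg_factor]) auto

text \<open>All terms added to 1 are nonnegative. The bound supplies the signs needed for
  \<open>ennreal\<close>, and it passes to the limit, which keeps \<open>h_fun\<close> away from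
  0.\<close>

lemma neg_factor_ge_1:
  assumes "0 \<le> K" "0 < \<theta>" "\<theta> < 1"
  shows "1 \<le> neg_factor K \<theta> n z"
proof (induction n arbitrary: z)
  case (Suc n)
  have "\<theta> ^ Suc n \<le> 1"
    using assms by (intro power_le_one) auto
  moreover have "0 \<le> integral {0..\<theta> * z} (\<lambda>x. exp (- x) * neg_factor K \<theta> n x)"
    by (intro integral_nonneg neg_factor_integrable mult_nonneg_nonneg order_trans[OF _ Suc.IH]) auto
  ultimately show ?case
    using assms by simp
qed simp

lemma neg_factor_nonpos: "0 < \<theta> \<Longrightarrow> z \<le> 0 \<Longrightarrow> neg_factor K \<theta> n z = 1"
proof (cases n)
  case (Suc m)
  assume "0 < \<theta>" "z \<le> 0"
  then have "\<theta> * z \<le> 0"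
    by (simp add: mult_nonneg_nonpos)
  then have "integral {0..\<theta> * z} (\<lambda>x. exp (- x) * neg_factor K \<theta> m x) = 0"
    by (cases "\<theta> * z = 0") auto
  then show ?thesis
    using Suc by simp
qed simp

section \<open>Explicit solution of the one-step recursion\<close>

text \<open>One formula serves both signs: for \<open>y \<ge> 0\<close> the
  \<open>neg_factor\<close> is 1, for \<open>y \<le> 0\<close> the exponential is 1. The decay rate
  is the geometric sum \<open>\<theta> + ... + \<theta> ^ n\<close>.\<close>

definition persist_value :: "real \<Rightarrow> real \<Rightarrow> nat \<Rightarrow> real \<Rightarrow> real" where
  "persist_value \<theta> \<xi> n y =
     ((1 - \<xi>) * (1 - \<theta>)) ^ n / qpoch \<theta> \<theta> n * neg_factor (\<xi> / ((1 - \<xi>) * (1 - \<theta>))) \<theta> n (- y)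
     * exp (- (\<theta> * (1 - \<theta> ^ n) / (1 - \<theta>)) * max 0 y)"

lemma qpoch_pos:
  assumes "0 < \<theta>" "\<theta> < 1"
  shows "0 < qpoch \<theta> \<theta> n"
  unfolding qpoch_def
proof (intro prod_pos ballI)
  fix k
  have "\<theta> ^ Suc k < 1"
    using assms by (intro power_Suc_less_one)
  then show "0 < 1 - \<theta> * \<theta> ^ k"
    by simp
qed

text \<open>Split at 0. The negative branch reflects into the integral in the next
  \<open>neg_factor\<close>; the positive branch is a pure exponential of rate \<open>1 + c\<close>,
  whose tail integral yields the next coefficient \<open>(1 - \<xi>) * a / (1 + c)\<close> and the
  next rate \<open>\<theta> * (1 + c)\<close>.\<close>

lemma nn_integral_persist_value:
  assumes \<theta>: "0 < \<theta>" "\<theta> < 1" and \<xi>: "0 \<le> \<xi>" "\<xi> < 1"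
  shows "(\<integral>\<^sup>+z. indicator {\<theta> * y<..} z * ennreal (persist_value \<theta> \<xi> n z)
      \<partial>density lborel (\<lambda>x. ennreal (phi \<xi> x))) = ennreal (persist_value \<theta> \<xi> (Suc n) y)"
proof -
  define lam where "lam = (1 - \<xi>) * (1 - \<theta>)"
  define K where "K = \<xi> / lam"
  define a where "a = lam ^ n / qpoch \<theta> \<theta> n"
  define c where "c = \<theta> * (1 - \<theta> ^ n) / (1 - \<theta>)"
  define G where "G = neg_factor K \<theta>"
  have lam: "0 < lam"
    using \<theta> \<xi> by (simp add: lam_def)
  have K: "0 \<le> K"
    using \<xi> lam by (simp add: K_def)
  have a: "0 < a"
    using lam qpoch_pos[OF \<theta>] by (simp add: a_def)
  have th: "\<theta> ^ n \<le> 1" "\<theta> ^ Suc n < 1"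
    using \<theta> by (auto intro!: power_le_one power_Suc_less_one simp del: power_Suc)
  have c: "0 \<le> c"
    using \<theta> th by (simp add: c_def)
  have c1: "1 + c = (1 - \<theta> ^ Suc n) / (1 - \<theta>)"
    using \<theta> by (simp add: c_def field_simps)
  have val: "persist_value \<theta> \<xi> n z = a * G n (- z) * exp (- c * max 0 z)" for z
    by (simp add: persist_value_def a_def c_def G_def K_def lam_def)
  have G1: "1 \<le> G n z" for z
    using neg_factor_ge_1[OF K \<theta>] by (simp add: G_def)
  have Gm [measurable]: "G n \<in> borel_measurable borel"
    unfolding G_def by (rule borel_measurable_continuous_onI[OF continuous_on_neg_factor])
  have [measurable]: "phi \<xi> \<in> borel_measurable borel"
    unfolding phi_def by measurable
  have [measurable]: "persist_value \<theta> \<xi> n \<in> borel_measurable borel"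
    unfolding val by measurable
  define f where "f z = \<xi> * a * (exp z * G n (- z))" for z
  define g where "g z = (1 - \<xi>) * a * exp (- (1 + c) * z)" for z
  have [measurable]: "f \<in> borel_measurable borel" "g \<in> borel_measurable borel"
    unfolding f_def g_def by measurable
  have f0: "0 \<le> f z" and g0: "0 \<le> g z" for z
    using a \<xi> G1[of "- z"] by (simp_all add: f_def g_def)
  let ?b = "max 0 (\<theta> * y)"
  \<comment> \<open>The two excluded points form a null set: at 0 the closed ranges may overlap and
    \<open>phi\<close> has its default value, and at \<open>\<theta> * y\<close> an open range has
    been closed. For \<open>y > 0\<close> the first range is empty.\<close>
  have split: "phi \<xi> z * (indicator {\<theta> * y<..} z * persist_value \<theta> \<xi> n z)
      = f z * indicator {\<theta> * y..0} z + g z * indicator {?b..} z" if "z \<noteq> 0" "z \<noteq> \<theta> * y" for z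
  proof (cases "z < 0")
    case True
    then show ?thesis
      using that by (auto simp: phi_def val f_def indicator_def max_def)
  next
    case False
    have "G n (- z) = 1"
      unfolding G_def using \<theta> False by (intro neg_factor_nonpos) auto
    moreover have "exp (- z) * exp (- (c * z)) = exp (- (1 + c) * z)"
      by (simp add: exp_add[symmetric] algebra_simps)
    ultimately show ?thesis
      using that False by (auto simp: phi_def val g_def indicator_def max_def)
  qed
  have "(\<integral>\<^sup>+z. indicator {\<theta> * y<..} z * ennreal (persist_value \<theta> \<xi> n z)
        \<partial>density lborel (\<lambda>x. ennreal (phi \<xi> x)))
      = (\<integral>\<^sup>+z. ennreal (phi \<xi> z) * (indicator {\<theta> * y<..} z * ennreal (persist_value \<theta> \<xi> n z)) \<partial>lborel)"
    by (rule nn_integral_density) measurable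
  also have "\<dots> = (\<integral>\<^sup>+z. ennreal (f z) * indicator {\<theta> * y..0} z
      + ennreal (g z) * indicator {?b..} z \<partial>lborel)"
  proof (rule nn_integral_cong_AE)
    have "AE z in lborel. z \<noteq> 0" "AE z in lborel. z \<noteq> \<theta> * y"
      by (rule AE_lborel_singleton)+
    then show "AE z in lborel.
        ennreal (phi \<xi> z) * (indicator {\<theta> * y<..} z * ennreal (persist_value \<theta> \<xi> n z))
        = ennreal (f z) * indicator {\<theta> * y..0} z + ennreal (g z) * indicator {?b..} z"
    proof eventually_elim
      case (elim z)
      have phi0: "0 \<le> phi \<xi> z"
        using \<xi> by (simp add: phi_def)
      have v0: "0 \<le> persist_value \<theta> \<xi> n z"
        using a G1[of "- z"] by (simp add: val)
      have "ennreal (phi \<xi> z) * (indicator {\<theta> * y<..} z * ennreal (persist_value \<theta> \<xi> n z))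
          = ennreal (phi \<xi> z * (indicator {\<theta> * y<..} z * persist_value \<theta> \<xi> n z))"
        using phi0 v0 by (auto simp: ennreal_mult' indicator_def)
      also have "\<dots> = ennreal (f z * indicator {\<theta> * y..0} z + g z * indicator {?b..} z)"
        using split[OF elim] by simp
      also have "\<dots> = ennreal (f z) * indicator {\<theta> * y..0} z + ennreal (g z) * indicator {?b..} z"
        using f0[of z] g0[of z] by (auto simp: indicator_def ennreal_plus)
      finally show ?case .
    qed
  qed
  also have "\<dots> = (\<integral>\<^sup>+z. ennreal (f z) * indicator {\<theta> * y..0} z \<partial>lborel)
      + (\<integral>\<^sup>+z. ennreal (g z) * indicator {?b..} z \<partial>lborel)"
    by (rule nn_integral_add) measurable
  also have "(\<integral>\<^sup>+z. ennreal (f z) * indicator {\<theta> * y..0} z \<partial>lborel)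
      = ennreal (\<xi> * a * integral {0..- (\<theta> * y)} (\<lambda>x. exp (- x) * G n x))"
  proof (rule nn_integral_has_integral_lebesgue'[OF f0])
    have "((\<lambda>x. exp (- x) * G n x) has_integral integral {0..- (\<theta> * y)} (\<lambda>x. exp (- x) * G n x))
        {0..- (\<theta> * y)}"
      unfolding G_def by (rule integrable_integral[OF neg_factor_integrable])
    then have "((\<lambda>x. exp (- (- x)) * G n (- x)) has_integral
        integral {0..- (\<theta> * y)} (\<lambda>x. exp (- x) * G n x)) {- (- (\<theta> * y))..- 0}"
      by (subst has_integral_reflect_real)
    then show "(f has_integral \<xi> * a * integral {0..- (\<theta> * y)} (\<lambda>x. exp (- x) * G n x)) {\<theta> * y..0}"
      unfolding f_def by (intro has_integral_mult_right) simp
  qed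
  also have "(\<integral>\<^sup>+z. ennreal (g z) * indicator {?b..} z \<partial>lborel)
      = ennreal ((1 - \<xi>) * a * (exp (- (1 + c) * ?b) / (1 + c)))"
  proof (rule nn_integral_has_integral_lebesgue'[OF g0])
    show "(g has_integral (1 - \<xi>) * a * (exp (- (1 + c) * ?b) / (1 + c))) {?b..}"
      unfolding g_def using c
      by (intro has_integral_mult_right has_integral_exp_minus_to_infinity) simp
  qed
  also have "ennreal (\<xi> * a * integral {0..- (\<theta> * y)} (\<lambda>x. exp (- x) * G n x))
      + ennreal ((1 - \<xi>) * a * (exp (- (1 + c) * ?b) / (1 + c)))
      = ennreal (\<xi> * a * integral {0..- (\<theta> * y)} (\<lambda>x. exp (- x) * G n x)
        + (1 - \<xi>) * a * (exp (- (1 + c) * ?b) / (1 + c)))"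
  proof (rule ennreal_plus[symmetric])
    have "0 \<le> exp (- x) * G n x" for x
      using G1[of x] by simp
    then have "0 \<le> integral {0..- (\<theta> * y)} (\<lambda>x. exp (- x) * G n x)"
      unfolding G_def by (intro integral_nonneg neg_factor_integrable) auto
    then show "0 \<le> \<xi> * a * integral {0..- (\<theta> * y)} (\<lambda>x. exp (- x) * G n x)"
      using \<xi> a by simp
  qed (use \<xi> a c in simp)
  also have "\<xi> * a * integral {0..- (\<theta> * y)} (\<lambda>x. exp (- x) * G n x)
        + (1 - \<xi>) * a * (exp (- (1 + c) * ?b) / (1 + c)) = persist_value \<theta> \<xi> (Suc n) y"
  proof -
    define J where "J = integral {0..- (\<theta> * y)} (\<lambda>x. exp (- x) * G n x)"
    have GSuc: "G (Suc n) (- y) = 1 + K * (1 - \<theta> ^ Suc n) * J"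
      by (simp add: G_def J_def)
    define a' where "a' = lam ^ Suc n / qpoch \<theta> \<theta> (Suc n)"
    have q: "qpoch \<theta> \<theta> (Suc n) = qpoch \<theta> \<theta> n * (1 - \<theta> ^ Suc n)"
      by (simp add: qpoch_def)
    \<comment> \<open>The factor \<open>1 - \<theta> ^ Suc n\<close> in the recursion of
      \<open>neg_factor\<close> cancels the new factor of \<open>qpoch\<close>, so the coefficient
      of \<open>J\<close> becomes \<open>K * lam * a = \<xi> * a\<close>, as in the
      integral.\<close>
    have aa: "a' * (1 - \<theta> ^ Suc n) = a * lam"
      using qpoch_pos[OF \<theta>, of n] th unfolding a'_def a_def q
      by (simp add: field_simps)
    have cc: "\<theta> * (1 + c) = \<theta> * (1 - \<theta> ^ Suc n) / (1 - \<theta>)"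
      using c1 by simp
    have P: "persist_value \<theta> \<xi> (Suc n) y = a' * (1 + K * (1 - \<theta> ^ Suc n) * J)
        * exp (- (\<theta> * (1 + c)) * max 0 y)"
      unfolding cc GSuc[symmetric]
      by (simp add: persist_value_def a'_def G_def K_def lam_def)
    have a'1: "(1 - \<xi>) * a / (1 + c) = a'"
    proof -
      have "a' = a * lam / (1 - \<theta> ^ Suc n)"
        using aa th by (simp add: field_simps)
      then show ?thesis
        unfolding c1 lam_def by simp
    qed
    have Kl: "K * lam = \<xi>"
      using lam by (simp add: K_def)
    show ?thesis
    proof (cases "y \<le> 0")
      case True
      then have "\<theta> * y \<le> 0"
        using \<theta> by (simp add: mult_nonneg_nonpos)
      then have b: "?b = 0" by simp
      have "a' * (1 + K * (1 - \<theta> ^ Suc n) * J) = a' + K * (a' * (1 - \<theta> ^ Suc n)) * J"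
        by (simp add: algebra_simps)
      also have "\<dots> = a' + (K * lam) * a * J"
        unfolding aa by simp
      finally show ?thesis
        unfolding P b J_def[symmetric] a'1[symmetric] Kl using True by simp
    next
      case False
      then have b: "?b = \<theta> * y" and "- (\<theta> * y) < 0"
        using \<theta> by (auto simp: max_def)
      then have J: "J = 0"
        by (simp add: J_def)
      show ?thesis
        unfolding P b J_def[symmetric] J a'1[symmetric] using False
        by (simp add: max_def algebra_simps)
    qed
  qed
  finally show ?thesis .
qed

text \<open>Both recursions agree step by step. The induction keeps \<open>s\<close> and
  \<open>y\<close> arbitrary because each step raises the start index and moves the base
  point.\<close>

lemma chain_prob_eq_persist_value:
  assumes D: "D = density lborel (\<lambda>x. ennreal (phi \<xi> x))" "prob_space D"
    and \<theta>: "0 < \<theta>" "\<theta> < 1" and \<xi>: "0 \<le> \<xi>" "\<xi> < 1"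
  shows "chain_prob D \<theta> n s y = ennreal (persist_value \<theta> \<xi> n y)"
proof (induction n arbitrary: s y)
  case 0
  show ?case
    by (simp add: chain_prob_0[OF D(2)] persist_value_def qpoch_def)
next
  case (Suc n)
  have "sets D = sets borel"
    by (simp add: D(1))
  then show ?case
    unfolding chain_prob_Suc[OF D(2) \<open>sets D = sets borel\<close>] Suc.IH
    using nn_integral_persist_value[OF \<theta> \<xi>] by (simp add: D(1))
qed

section \<open>The power series of \<open>h_fun\<close> and its Volterra equation\<close>

text \<open>Each factor of \<open>qpoch\<close> is at most \<open>1 + \<bar>b\<bar>\<close> in
  modulus, so an exponential series dominates. Convergence for every \<open>w\<close> permits
  termwise differentiation.\<close>

lemma summable_qpoch_exp:
  fixes b \<theta> w :: real
  assumes "0 < \<theta>" "\<theta> < 1"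
  shows "summable (\<lambda>m. qpoch b \<theta> m / fact m * w ^ m)"
proof (rule summable_comparison_test')
  show "summable (\<lambda>m. inverse (fact m) * ((1 + \<bar>b\<bar>) * \<bar>w\<bar>) ^ m)"
    by (rule summable_exp)
  fix m :: nat
  have "\<bar>qpoch b \<theta> m\<bar> \<le> (\<Prod>k<m. 1 + \<bar>b\<bar>)"
    unfolding qpoch_def abs_prod
  proof (rule prod_mono, safe)
    fix k
    have "\<bar>b * \<theta> ^ k\<bar> \<le> \<bar>b\<bar> * 1"
      unfolding abs_mult using assms by (intro mult_left_mono) (auto simp: power_le_one)
    then show "\<bar>1 - b * \<theta> ^ k\<bar> \<le> 1 + \<bar>b\<bar>"
      by linarith
  qed simp
  then have "\<bar>qpoch b \<theta> m\<bar> \<le> (1 + \<bar>b\<bar>) ^ m"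
    by simp
  then have "\<bar>qpoch b \<theta> m\<bar> * (\<bar>w\<bar> ^ m / fact m) \<le> (1 + \<bar>b\<bar>) ^ m * (\<bar>w\<bar> ^ m / fact m)"
    by (intro mult_right_mono) auto
  moreover have "norm (qpoch b \<theta> m / fact m * w ^ m) = \<bar>qpoch b \<theta> m\<bar> * (\<bar>w\<bar> ^ m / fact m)"
    by (simp add: abs_mult power_abs)
  moreover have "inverse (fact m) * ((1 + \<bar>b\<bar>) * \<bar>w\<bar>) ^ m = (1 + \<bar>b\<bar>) ^ m * (\<bar>w\<bar> ^ m / fact m)"
    unfolding power_mult_distrib by (simp add: divide_inverse)
  ultimately show "norm (qpoch b \<theta> m / fact m * w ^ m) \<le> inverse (fact m) * ((1 + \<bar>b\<bar>) * \<bar>w\<bar>) ^ m"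
    by simp
qed

lemma h_fun_0: "h_fun \<theta> \<xi> lam 0 = 1"
proof -
  have "(\<Sum>m. (- (\<theta> * 0 / (1 - \<theta>))) ^ m / fact m * qpoch (- \<xi> / lam * (1 - \<theta>)) \<theta> m)
      = (\<Sum>m. qpoch (- \<xi> / lam * (1 - \<theta>)) \<theta> m / fact m * 0 ^ m)"
    by (intro suminf_cong) simp
  also have "\<dots> = 1"
    by (subst powser_zero) (simp add: qpoch_def)
  finally show ?thesis
    by (simp add: h_fun_def)
qed

text \<open>The recurrence of \<open>qpoch\<close> gives the series \<open>S\<close> the derivative
  \<open>S w - b * S (\<theta> * w)\<close>; the exponential prefactor removes the first term,
  leaving only the value at the contracted argument.\<close>

lemma h_fun_has_derivative:
  assumes \<theta>: "0 < \<theta>" "\<theta> < 1"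
  shows "((\<lambda>z. h_fun \<theta> \<xi> lam (- z)) has_real_derivative
    \<xi> / lam * \<theta> * exp (- (\<theta> * z)) * h_fun \<theta> \<xi> lam (- (\<theta> * z))) (at z)"
proof -
  define b where "b = - \<xi> / lam * (1 - \<theta>)"
  define c where "c m = qpoch b \<theta> m / fact m" for m
  define r where "r = \<theta> / (1 - \<theta>)"
  define S where "S w = (\<Sum>m. c m * w ^ m)" for w
  have h: "h_fun \<theta> \<xi> lam (- z) = exp (- (r * z)) * S (r * z)" for z
    by (simp add: h_fun_def S_def c_def r_def b_def mult.commute)
  have sum: "summable (\<lambda>m. c m * w ^ m)" for w
    unfolding c_def by (rule summable_qpoch_exp[OF \<theta>])
  \<comment> \<open>Differentiation cancels \<open>m + 1\<close> in the factorial, and the last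
    factor \<open>1 - b * \<theta> ^ m\<close> of \<open>qpoch\<close> splits the coefficient into
    an unscaled and a rescaled part.\<close>
  have "diffs c m * w ^ m = c m * w ^ m - b * (c m * (\<theta> * w) ^ m)" for m w
    by (simp add: diffs_def c_def qpoch_def power_mult_distrib field_simps del: of_nat_Suc)
  then have "(\<Sum>m. diffs c m * w ^ m) = S w - b * S (\<theta> * w)" for w
    unfolding S_def
    using suminf_diff[OF sum[of w] summable_mult[OF sum[of "\<theta> * w"], of b]]
      suminf_mult[OF sum[of "\<theta> * w"], of b] by simp
  then have dS: "(S has_real_derivative S w - b * S (\<theta> * w)) (at w)" for w
    using termdiffs_strong_converges_everywhere[of c w] sum unfolding S_def by simp
  have dS': "((\<lambda>z. S (r * z)) has_real_derivative (S (r * z) - b * S (\<theta> * (r * z))) * r) (at z)"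
    by (rule DERIV_chain2[OF dS]) (auto intro!: derivative_eq_intros)
  have "((\<lambda>z. exp (- (r * z)) * S (r * z)) has_real_derivative
      exp (- (r * z)) * ((S (r * z) - b * S (\<theta> * (r * z))) * r)
      + exp (- (r * z)) * (- r) * S (r * z)) (at z)"
    by (rule derivative_eq_intros dS' refl | simp)+
  moreover have "exp (- (r * z)) * ((S (r * z) - b * S (\<theta> * (r * z))) * r)
      + exp (- (r * z)) * (- r) * S (r * z)
      = \<xi> / lam * \<theta> * exp (- (\<theta> * z)) * h_fun \<theta> \<xi> lam (- (\<theta> * z))"
  proof -
    \<comment> \<open>This splits \<open>exp (- (r * z))\<close> so that one part recombines with
      \<open>S (r * (\<theta> * z))\<close> into \<open>h_fun\<close> at
      \<open>- (\<theta> * z)\<close>.\<close>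
    have r: "r = \<theta> + r * \<theta>"
      using \<theta> by (simp add: r_def field_simps)
    have br: "- b * r = \<xi> / lam * \<theta>"
      using \<theta> by (simp add: b_def r_def)
    have "- (r * z) = - (\<theta> * z) + - (r * (\<theta> * z))"
      by (subst r) (simp add: algebra_simps)
    then have e: "exp (- (r * z)) = exp (- (\<theta> * z)) * exp (- (r * (\<theta> * z)))"
      by (simp only: exp_add)
    have "exp (- (r * z)) * ((S (r * z) - b * S (\<theta> * (r * z))) * r)
        + exp (- (r * z)) * (- r) * S (r * z) = (- b * r) * exp (- (r * z)) * S (\<theta> * (r * z))"
      by (simp add: algebra_simps)
    also have "\<dots> = (- b * r) * exp (- (\<theta> * z)) * (exp (- (r * (\<theta> * z))) * S (r * (\<theta> * z)))"
      unfolding e by (simp add: mult_ac)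
    finally show ?thesis
      unfolding br h .
  qed
  ultimately show ?thesis
    unfolding h by simp
qed

lemma h_fun_integral_equation:
  assumes \<theta>: "0 < \<theta>" "\<theta> < 1" and z: "0 \<le> z"
  shows "((\<lambda>x. \<xi> / lam * (exp (- x) * h_fun \<theta> \<xi> lam (- x))) has_integral
    h_fun \<theta> \<xi> lam (- z) - 1) {0..\<theta> * z}"
proof -
  \<comment> \<open>Substituting \<open>z = x / \<theta>\<close> moves the contraction from the
    integrand to the upper limit, and its inner derivative cancels the factor
    \<open>\<theta>\<close>.\<close>
  have "((\<lambda>x. h_fun \<theta> \<xi> lam (- (x / \<theta>))) has_real_derivative
      \<xi> / lam * (exp (- x) * h_fun \<theta> \<xi> lam (- x))) (at x)" for x
  proof -
    have "((\<lambda>x. h_fun \<theta> \<xi> lam (- (x / \<theta>))) has_real_derivative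
        (\<xi> / lam * \<theta> * exp (- (\<theta> * (x / \<theta>))) * h_fun \<theta> \<xi> lam (- (\<theta> * (x / \<theta>)))) * (1 / \<theta>)) (at x)"
      by (rule DERIV_chain2[OF h_fun_has_derivative[OF \<theta>]])
        (use \<theta> in \<open>auto intro!: derivative_eq_intros\<close>)
    then show ?thesis
      using \<theta> by simp
  qed
  then have "((\<lambda>x. \<xi> / lam * (exp (- x) * h_fun \<theta> \<xi> lam (- x))) has_integral
      h_fun \<theta> \<xi> lam (- (\<theta> * z / \<theta>)) - h_fun \<theta> \<xi> lam (- (0 / \<theta>))) {0..\<theta> * z}"
    using \<theta> z by (intro fundamental_theorem_of_calculus)
      (auto simp: has_real_derivative_iff_has_vector_derivative[symmetric] has_field_derivative_at_within)
  then show ?thesis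
    using \<theta> by (simp add: h_fun_0)
qed

section \<open>Convergence of the correction factor to \<open>h_fun\<close>\<close>

text \<open>The weight \<open>exp (L z)\<close> with \<open>L = 2 (K + 1) / \<theta>\<close> turns each integration into a factor at most
  \<open>\<theta> / 2\<close>, which also leaves room for the error of order \<open>\<theta> ^ n\<close> in the factor \<open>1 - \<theta> ^ Suc n\<close>.\<close>

lemma neg_factor_error:
  fixes \<theta> \<xi> lam A H :: real
  defines "K \<equiv> \<xi> / lam"
  assumes \<theta>: "0 < \<theta>" "\<theta> < 1" and K: "0 \<le> K"
    and H: "\<And>z. 0 \<le> z \<Longrightarrow> z \<le> A \<Longrightarrow> \<bar>h_fun \<theta> \<xi> lam (- z)\<bar> \<le> H"
    and z: "0 \<le> z" "z \<le> A"
  shows "\<bar>neg_factor K \<theta> n z - h_fun \<theta> \<xi> lam (- z)\<bar> \<le> (1 + H) * \<theta> ^ n * exp (2 * (K + 1) / \<theta> * z)"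
  using z
proof (induction n arbitrary: z)
  case 0
  \<comment> \<open>Since \<open>neg_factor\<close> starts at 1, the initial error is at most
    \<open>1 + H\<close>, the constant carried through the induction.\<close>
  have "\<bar>h_fun \<theta> \<xi> lam (- z)\<bar> \<le> H" by (rule H) (fact 0)+
  moreover have "1 \<le> exp (2 * (K + 1) / \<theta> * z)"
    using K \<theta> 0 by simp
  then have "(1 + H) * 1 \<le> (1 + H) * exp (2 * (K + 1) / \<theta> * z)"
    using calculation by (intro mult_left_mono) auto
  ultimately show ?case
    by simp
next
  case (Suc n)
  define L where "L = 2 * (K + 1) / \<theta>"
  have L: "0 < L"
    using K \<theta> by (simp add: L_def)
  define h where "h x = h_fun \<theta> \<xi> lam (- x)" for x
  define G where "G = neg_factor K \<theta>"
  have H0: "0 \<le> H"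
    using H[OF Suc.prems] by linarith
  have th: "0 < \<theta> ^ Suc n" "\<theta> ^ Suc n \<le> 1" "\<theta> ^ Suc n \<le> \<theta> ^ n"
    using \<theta> by (auto intro!: power_le_one power_decreasing simp del: power_Suc)
  have tz: "\<theta> * z \<le> z" "0 \<le> \<theta> * z"
    using \<theta> Suc.prems mult_right_mono[of \<theta> 1 z] by auto
  have iG: "((\<lambda>x. K * (1 - \<theta> ^ Suc n) * (exp (- x) * G n x)) has_integral G (Suc n) z - 1) {0..\<theta> * z}"
    using has_integral_mult_right[OF integrable_integral[OF neg_factor_integrable], of "K * (1 - \<theta> ^ Suc n)"]
    by (simp add: G_def)
  have ih: "((\<lambda>x. K * (exp (- x) * h x)) has_integral h z - 1) {0..\<theta> * z}"
    unfolding K_def h_def by (rule h_fun_integral_equation[OF \<theta> Suc.prems(1)])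
  have i: "((\<lambda>x. K * (1 - \<theta> ^ Suc n) * (exp (- x) * G n x) - K * (exp (- x) * h x)) has_integral
      G (Suc n) z - h z) {0..\<theta> * z}"
    using has_integral_diff[OF iG ih] by simp
  \<comment> \<open>The factor 2 collects two equal contributions: the induction hypothesis, and the
    bound on \<open>\<theta> ^ Suc n * h x\<close> from replacing
    \<open>1 - \<theta> ^ Suc n\<close> by 1.\<close>
  define B where "B x = K * (2 * (1 + H) * \<theta> ^ n) * exp (L * x)" for x
  have iB: "(B has_integral K * (2 * (1 + H) * \<theta> ^ n) * (exp (L * (\<theta> * z)) / L - 1 / L)) {0..\<theta> * z}"
  proof -
    have "((\<lambda>x. exp (L * x)) has_integral exp (L * (\<theta> * z)) / L - exp (L * 0) / L) {0..\<theta> * z}"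
      by (rule fundamental_theorem_of_calculus)
        (use tz L in \<open>auto intro!: derivative_eq_intros
          simp: has_real_derivative_iff_has_vector_derivative[symmetric]\<close>)
    then show ?thesis
      unfolding B_def by (intro has_integral_mult_right) simp
  qed
  have bound: "norm (K * (1 - \<theta> ^ Suc n) * (exp (- x) * G n x) - K * (exp (- x) * h x)) \<le> B x"
    if "x \<in> {0..\<theta> * z}" for x
  proof -
    have x: "0 \<le> x" "x \<le> A"
      using that tz Suc.prems by auto
    have IH: "\<bar>G n x - h x\<bar> \<le> (1 + H) * \<theta> ^ n * exp (L * x)"
      unfolding G_def h_def L_def by (rule Suc.IH[OF x])
    have hx: "\<bar>h x\<bar> \<le> H"
      unfolding h_def by (rule H[OF x])
    have e1: "1 \<le> exp (L * x)"
      using L x by simp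
    have "\<bar>(1 - \<theta> ^ Suc n) * (G n x - h x) - \<theta> ^ Suc n * h x\<bar>
        \<le> (1 - \<theta> ^ Suc n) * \<bar>G n x - h x\<bar> + \<theta> ^ Suc n * \<bar>h x\<bar>"
      using th by (intro order_trans[OF abs_triangle_ineq4]) (simp add: abs_mult del: power_Suc)
    also have "\<dots> \<le> 1 * \<bar>G n x - h x\<bar> + \<theta> ^ n * ((1 + H) * exp (L * x))"
    proof (intro add_mono mult_mono)
      have "(1 + H) * 1 \<le> (1 + H) * exp (L * x)"
        using H0 e1 by (intro mult_left_mono) auto
      then have "H \<le> (1 + H) * exp (L * x)"
        by simp
      then show "\<bar>h x\<bar> \<le> (1 + H) * exp (L * x)"
        by (rule order_trans[OF hx])
    qed (use th \<theta> in auto)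
    also have "\<dots> \<le> (2 * (1 + H) * \<theta> ^ n) * exp (L * x)"
      using IH by (simp add: algebra_simps)
    finally have main: "\<bar>(1 - \<theta> ^ Suc n) * (G n x - h x) - \<theta> ^ Suc n * h x\<bar>
      \<le> (2 * (1 + H) * \<theta> ^ n) * exp (L * x)" .
    have "norm (K * (1 - \<theta> ^ Suc n) * (exp (- x) * G n x) - K * (exp (- x) * h x))
        = K * (exp (- x) * \<bar>(1 - \<theta> ^ Suc n) * (G n x - h x) - \<theta> ^ Suc n * h x\<bar>)"
    proof -
      have "K * (1 - \<theta> ^ Suc n) * (exp (- x) * G n x) - K * (exp (- x) * h x)
          = K * (exp (- x) * ((1 - \<theta> ^ Suc n) * (G n x - h x) - \<theta> ^ Suc n * h x))"
        by (simp add: algebra_simps)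
      then show ?thesis
        using K by (simp only: real_norm_def abs_mult abs_of_nonneg abs_exp_cancel)
    qed
    also have "\<dots> \<le> K * (1 * ((2 * (1 + H) * \<theta> ^ n) * exp (L * x)))"
      using K x main by (intro mult_left_mono mult_mono) auto
    finally show ?thesis
      by (simp add: B_def mult_ac)
  qed
  have "\<bar>G (Suc n) z - h z\<bar> \<le> K * (2 * (1 + H) * \<theta> ^ n) * (exp (L * (\<theta> * z)) / L - 1 / L)"
    using integral_norm_bound_integral[OF has_integral_integrable[OF i] has_integral_integrable[OF iB] bound]
    unfolding integral_unique[OF i] integral_unique[OF iB] by simp
  also have "\<dots> \<le> K * (2 * (1 + H) * \<theta> ^ n) * (exp (L * z) / L)"
  proof (rule mult_left_mono)
    have "exp (L * (\<theta> * z)) \<le> exp (L * z)"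
      using L tz by simp
    then have "exp (L * (\<theta> * z)) / L \<le> exp (L * z) / L"
      using L by (intro divide_right_mono) auto
    then show "exp (L * (\<theta> * z)) / L - 1 / L \<le> exp (L * z) / L"
      using L by (smt (verit) divide_pos_pos)
  qed (use K H0 \<theta> in simp)
  also have "\<dots> = (2 * K / L) * ((1 + H) * \<theta> ^ n * exp (L * z))"
    by simp
  also have "\<dots> \<le> \<theta> * ((1 + H) * \<theta> ^ n * exp (L * z))"
  proof (rule mult_right_mono)
    \<comment> \<open>By the choice of \<open>L\<close> the left side is
      \<open>\<theta> * K / (K + 1)\<close>; this gives the extra power of
      \<open>\<theta>\<close>.\<close>
    show "2 * K / L \<le> \<theta>"
      using K \<theta> by (simp add: L_def field_simps)
  qed (use H0 \<theta> in simp)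
  finally show ?case
    by (simp add: G_def h_def L_def mult_ac)
qed

lemma neg_factor_tendsto:
  assumes \<theta>: "0 < \<theta>" "\<theta> < 1" and K: "0 \<le> \<xi> / lam" and z: "0 \<le> z"
  shows "(\<lambda>n. neg_factor (\<xi> / lam) \<theta> n z) \<longlonglongrightarrow> h_fun \<theta> \<xi> lam (- z)"
proof -
  \<comment> \<open>Compactness of \<open>{0..z}\<close> provides \<open>H\<close>; no larger range
    matters because the integrals only run up to \<open>\<theta> * z\<close>.\<close>
  have "continuous_on {0..z} (\<lambda>x. h_fun \<theta> \<xi> lam (- x))"
    by (intro continuous_at_imp_continuous_on ballI DERIV_isCont[OF h_fun_has_derivative[OF \<theta>]])
  then have "bounded ((\<lambda>x. h_fun \<theta> \<xi> lam (- x)) ` {0..z})"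
    by (intro compact_imp_bounded compact_continuous_image) auto
  then obtain H where "\<forall>v\<in>(\<lambda>x. h_fun \<theta> \<xi> lam (- x)) ` {0..z}. norm v \<le> H"
    unfolding bounded_iff ..
  then have H: "\<bar>h_fun \<theta> \<xi> lam (- x)\<bar> \<le> H" if "0 \<le> x" "x \<le> z" for x
    using that by simp
  have "(\<lambda>n. (1 + H) * \<theta> ^ n * exp (2 * (\<xi> / lam + 1) / \<theta> * z)) \<longlonglongrightarrow>
      (1 + H) * 0 * exp (2 * (\<xi> / lam + 1) / \<theta> * z)"
    using \<theta> by (intro tendsto_intros LIMSEQ_power_zero) auto
  then have lim: "(\<lambda>n. (1 + H) * \<theta> ^ n * exp (2 * (\<xi> / lam + 1) / \<theta> * z)) \<longlonglongrightarrow> 0"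
    by simp
  have "norm (neg_factor (\<xi> / lam) \<theta> n z - h_fun \<theta> \<xi> lam (- z))
      \<le> (1 + H) * \<theta> ^ n * exp (2 * (\<xi> / lam + 1) / \<theta> * z)" for n
    unfolding real_norm_def by (rule neg_factor_error[OF \<theta> K H z order_refl])
  then have "(\<lambda>n. neg_factor (\<xi> / lam) \<theta> n z - h_fun \<theta> \<xi> lam (- z)) \<longlonglongrightarrow> 0"
    by (intro Lim_null_comparison[OF _ lim] always_eventually allI)
  then show ?thesis
    by (rule LIM_zero_cancel)
qed

section \<open>The infinite product and the final asymptotics\<close>

text \<open>The deviations of the factors from 1 form a geometric series, so the product converges
  absolutely; as no factor is zero, neither is the limit.\<close>

lemma qpoch_tendsto_qpoch_inf:
  assumes \<theta>: "0 < \<theta>" "\<theta> < 1"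
  shows "qpoch \<theta> \<theta> \<longlonglongrightarrow> qpoch_inf \<theta> \<theta>" and "qpoch_inf \<theta> \<theta> \<noteq> 0"
proof -
  have "summable (\<lambda>i. norm (1 - \<theta> * \<theta> ^ i - 1))"
    using \<theta> by (simp add: abs_mult summable_mult summable_geometric power_abs[symmetric])
  then have conv: "convergent_prod (\<lambda>i. 1 - \<theta> * \<theta> ^ i)"
    by (intro abs_convergent_prod_imp_convergent_prod summable_imp_abs_convergent_prod)
  \<comment> \<open>Partial products of \<open>convergent_prod_LIMSEQ\<close> run over
    \<open>{..n}\<close>, hence have \<open>n + 1\<close> factors.\<close>
  have "(\<lambda>n. qpoch \<theta> \<theta> (Suc n)) \<longlonglongrightarrow> qpoch_inf \<theta> \<theta>"
    using convergent_prod_LIMSEQ[OF conv] by (simp add: qpoch_def qpoch_inf_def lessThan_Suc_atMost)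
  then show "qpoch \<theta> \<theta> \<longlonglongrightarrow> qpoch_inf \<theta> \<theta>"
    by (rule LIMSEQ_imp_Suc)
  have "\<theta> ^ Suc k < 1" for k
    using \<theta> by (intro power_Suc_less_one)
  then have "1 - \<theta> * \<theta> ^ k \<noteq> 0" for k
    by (metis eq_iff_diff_eq_0 less_irrefl power_Suc)
  then show "qpoch_inf \<theta> \<theta> \<noteq> 0"
    unfolding qpoch_inf_def by (intro prodinf_nonzero conv)
qed

theorem lemma3p8:
  fixes M :: "'a measure" and X :: "nat \<Rightarrow> 'a \<Rightarrow> real" and \<theta> \<xi> y lam :: real
  assumes "prob_space M"
    and "prob_space.indep_vars M (\<lambda>_. borel) X UNIV"
    and "\<And>i. distributed M lborel (X i) (\<lambda>x. ennreal (phi \<xi> x))"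
    and "0 < \<theta>" and "\<theta> < 1"
    and "0 \<le> \<xi>" and "\<xi> < 1"
    and "y \<le> 0"
    and "lam = (1 - \<xi>) * (1 - \<theta>)"
  shows "(\<lambda>n. persist_prob M X \<theta> y n) \<sim>[at_top]
         (\<lambda>n. 1 / (lam * qpoch_inf \<theta> \<theta>) * h_fun \<theta> \<xi> lam y * lam ^ (n + 1))"
proof -
  interpret prob_space M by fact
  note \<theta> = assms(4,5) and \<xi> = assms(6,7)
  define D where "D = density lborel (\<lambda>x. ennreal (phi \<xi> x))"
  have distr: "distr M borel (X i) = D" for i
  proof -
    have "distr M borel (X i) = distr M lborel (X i)"
      by (rule distr_cong) auto
    then show ?thesis
      using distributed_distr_eq_density[OF assms(3)[of i]] by (simp add: D_def)
  qed
  \<comment> \<open>That \<open>D\<close> has total mass 1 follows from its being the law of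
    \<open>X 0\<close>, without integrating \<open>phi\<close>.\<close>
  have "random_variable borel (X 0)"
    using distributed_measurable[OF assms(3)[of 0]] by simp
  then have "prob_space D"
    using prob_space_distr[of "X 0" borel] by (simp add: distr)
  have lam: "0 < lam"
    using \<theta> \<xi> by (simp add: assms(9))
  have K: "0 \<le> \<xi> / lam"
    using lam \<xi> by simp
  let ?G = "\<lambda>n. neg_factor (\<xi> / lam) \<theta> n (- y)"
  have G1: "1 \<le> ?G n" for n
    by (rule neg_factor_ge_1[OF K \<theta>])
  have persist: "persist_prob M X \<theta> y n = lam ^ n / qpoch \<theta> \<theta> n * ?G n" if "0 < n" for n
  proof -
    have "ennreal (persist_prob M X \<theta> y n) = ennreal (persist_value \<theta> \<xi> n y)"
      using persist_prob_eq_chain_prob[OF assms(1,2) distr that]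
        chain_prob_eq_persist_value[OF D_def \<open>prob_space D\<close> \<theta> \<xi>] by simp
    moreover have "persist_value \<theta> \<xi> n y = lam ^ n / qpoch \<theta> \<theta> n * ?G n"
      using assms(8) by (simp add: persist_value_def assms(9))
    moreover have "0 \<le> lam ^ n / qpoch \<theta> \<theta> n * ?G n"
      using lam G1[of n] qpoch_pos[OF \<theta>, of n] by simp
    moreover have "0 \<le> persist_prob M X \<theta> y n"
      by (simp add: persist_prob_def)
    ultimately show ?thesis
      by simp
  qed
  have G: "?G \<longlonglongrightarrow> h_fun \<theta> \<xi> lam y"
    using neg_factor_tendsto[OF \<theta> K, of "- y"] assms(8) by simp
  \<comment> \<open>This makes division by \<open>h_fun\<close> legitimate in the quotient
    below.\<close>
  then have h: "1 \<le> h_fun \<theta> \<xi> lam y"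
    by (rule LIMSEQ_le_const) (use G1 in blast)
  let ?q = "qpoch_inf \<theta> \<theta>"
  \<comment> \<open>In the quotient of the two sequences the powers of \<open>lam\<close> cancel
    against \<open>1 / lam\<close>, leaving these two ratios, each tending to 1.\<close>
  have "(\<lambda>n. (?G n / h_fun \<theta> \<xi> lam y) * (?q / qpoch \<theta> \<theta> n)) \<longlonglongrightarrow>
      (h_fun \<theta> \<xi> lam y / h_fun \<theta> \<xi> lam y) * (?q / ?q)"
    using h qpoch_tendsto_qpoch_inf[OF \<theta>] by (intro tendsto_intros G) auto
  moreover have "(h_fun \<theta> \<xi> lam y / h_fun \<theta> \<xi> lam y) * (?q / ?q) = 1"
    using h qpoch_tendsto_qpoch_inf[OF \<theta>] by simp
  moreover have "\<forall>\<^sub>F n in at_top. (?G n / h_fun \<theta> \<xi> lam y) * (?q / qpoch \<theta> \<theta> n) =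
      persist_prob M X \<theta> y n / (1 / (lam * ?q) * h_fun \<theta> \<xi> lam y * lam ^ (n + 1))"
    using eventually_gt_at_top[of 0]
  proof eventually_elim
    case (elim n)
    show ?case
      unfolding persist[OF elim]
      using lam h qpoch_pos[OF \<theta>, of n] qpoch_tendsto_qpoch_inf[OF \<theta>] by (simp add: field_simps)
  qed
  ultimately have "(\<lambda>n. persist_prob M X \<theta> y n /
      (1 / (lam * ?q) * h_fun \<theta> \<xi> lam y * lam ^ (n + 1))) \<longlonglongrightarrow> 1"
    using Lim_transform_eventually by fastforce
  then show ?thesis
    by (rule asymp_equivI')
qed

end
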